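(* Let $m\in\mathbb{N}_0$. Then for all real $x\ge 1$ and $y\ge 1$, $$\left[\beta^{(m)}(xy)\right]^2\le\beta^{(m)}(x)\,\beta^{(m)}(y).$$
   Context: Nielsen's $\beta$-function is the function $\beta:(0,\infty)\to\mathbb{R}$ defined by $\beta(x)=\int_0^1 \frac{t^{x-1}}{1+t}\,dt=\int_0^\infty\frac{e^{-xt}}{1+e^{-t}}\,dt$ for $x>0$. For $m\in\mathbb{N}_0=\{0,1,2,\dots\}$, $\beta^{(m)}$ denotes its $m$-th derivative, with $\beta^{(0)}=\beta$. *)

theory Defs
  imports "HOL-Analysis.Analysis"
begin

(* Only meaningful for x > 0.  For 0 < x < 1 the integrand is unbounded at 0 but still
   (absolutely) integrable, which the gauge integral covers; its value at t = 0 is irrelevant. *)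
definition nielsen_beta :: "real \<Rightarrow> real" where
  "nielsen_beta x = integral {0..1} (\<lambda>t. t powr (x - 1) / (1 + t))"

(* For x > 0, the derivatives at x depend only on the values of nielsen_beta on {0<..}. *)
definition nielsen_beta_deriv :: "nat \<Rightarrow> real \<Rightarrow> real" where
  "nielsen_beta_deriv m = (deriv ^^ m) nielsen_beta"

end

theory Submission
  imports Defs "HOL-Real_Asymp.Real_Asymp"
begin

text \<open>
  The inequality is a consequence of monotonicity alone. The function
  \<open>(- 1) ^ m * \<beta>\<^sup>(\<^sup>m\<^sup>) x\<close> is nonnegative and decreasing on the positive half-line, and
  \<open>x y\<close> is at least as large as both \<open>x\<close> and \<open>y\<close> when these are at least 1. So the value at
  \<open>x y\<close> is bounded by each of the values at \<open>x\<close> and \<open>y\<close>, and multiplying the two bounds makes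
  the sign \<open>(- 1) ^ m\<close> disappear.

  The monotonicity is the complete monotonicity of \<open>\<beta>\<close>. To avoid differentiating under the
  integral sign, \<open>\<beta>\<close> is expressed by polygamma functions (\<open>nielsen_beta_eq_Digamma\<close>):
  \[ \beta(x) = \frac12 \left(\psi\left(\frac{x+1}2\right) - \psi\left(\frac x2\right)\right). \]
  Both sides are nonnegative solutions of \<open>f x + f (x + 1) = 1 / x\<close>, and there is only one such
  solution (\<open>reflection_solution_unique\<close>). All derivatives of the right-hand side are known, and
  their signs alternate because the polygamma functions are alternately increasing and decreasing.
  Monotonicity of \<open>\<beta>\<^sup>(\<^sup>m\<^sup>)\<close> is then the sign of the next derivative.
\<close>

text \<open>
  Nonnegativity forces \<open>0 \<le> f x \<le> 1 / x\<close>, hence \<open>f\<close> tends to 0 at infinity. The difference of two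
  solutions changes sign under the shift by 1, so it is periodic with period 2, and a periodic
  function that tends to 0 vanishes.
\<close>

lemma reflection_solution_unique:
  fixes f g :: "real \<Rightarrow> real"
  assumes f: "\<And>x. x > 0 \<Longrightarrow> f x + f (x + 1) = 1 / x" and f0: "\<And>x. x > 0 \<Longrightarrow> f x \<ge> 0"
    and g: "\<And>x. x > 0 \<Longrightarrow> g x + g (x + 1) = 1 / x" and g0: "\<And>x. x > 0 \<Longrightarrow> g x \<ge> 0"
    and x: "x > 0"
  shows "f x = g x"
proof -
  have periodic: "f x - g x = f (x + 2 * real n) - g (x + 2 * real n)" for n
  proof (induction n)
    case (Suc n)
    define z where "z = x + 2 * real n"
    have "z > 0" using x by (simp add: z_def)
    then have "f z - g z = f (z + 2) - g (z + 2)"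
      using f[of z] f[of "z + 1"] g[of z] g[of "z + 1"] by (simp add: add.assoc)
    moreover have "z + 2 = x + 2 * real (Suc n)" by (simp add: z_def)
    ultimately show ?case using Suc.IH unfolding z_def by metis
  qed simp
  have bound: "\<bar>f z - g z\<bar> \<le> 1 / z" if "z > 0" for z
    using f[of z] f0[of z] f0[of "z + 1"] g[of z] g0[of z] g0[of "z + 1"] that by simp
  have "(\<lambda>n. 1 / (x + 2 * real n)) \<longlonglongrightarrow> 0"
    by real_asymp
  moreover have "\<bar>f x - g x\<bar> \<le> 1 / (x + 2 * real n)" for n
    using bound[of "x + 2 * real n"] periodic[of n] x by simp
  ultimately have "\<bar>f x - g x\<bar> \<le> 0"
    by (intro LIMSEQ_le_const) auto
  then show ?thesis by simp
qed

lemma nielsen_beta_integrable: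
  fixes x :: real
  assumes "x > 0"
  shows "(\<lambda>t. t powr (x - 1) / (1 + t)) integrable_on {0..1}"
proof -
  have "(\<lambda>t. t powr (x - 1)) absolutely_integrable_on {0..1}"
    using assms by (intro nonnegative_absolutely_integrable_1 integrable_on_powr_from_0) auto
  moreover have "continuous_on {0..1} (\<lambda>t::real. 1 / (1 + t))"
    by (intro continuous_intros) auto
  ultimately have "(\<lambda>t. 1 / (1 + t) * t powr (x - 1)) absolutely_integrable_on {0..1}"
    by (intro absolutely_integrable_bounded_measurable_product_real
        continuous_imp_measurable_on_sets_lebesgue compact_imp_bounded compact_continuous_image) auto
  then show ?thesis
    by (auto dest: set_lebesgue_integral_eq_integral(1))
qed

lemma nielsen_beta_nonneg:
  "x > 0 \<Longrightarrow> nielsen_beta x \<ge> 0"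
  unfolding nielsen_beta_def by (intro integral_nonneg nielsen_beta_integrable) auto

lemma nielsen_beta_reflection:
  assumes "x > 0"
  shows "nielsen_beta x + nielsen_beta (x + 1) = 1 / x"
proof -
  have "nielsen_beta x + nielsen_beta (x + 1)
      = integral {0..1} (\<lambda>t. t powr (x - 1) / (1 + t) + t powr (x + 1 - 1) / (1 + t))"
    unfolding nielsen_beta_def
    using assms by (intro integral_add[symmetric] nielsen_beta_integrable) auto
  also have "\<dots> = integral {0..1} (\<lambda>t. t powr (x - 1))"
  proof (rule integral_cong)
    fix t :: real assume t: "t \<in> {0..1}"
    have "t powr x = t powr (x - 1) * t"
      using t by (cases "t = 0") (simp_all add: powr_diff)
    then have "t powr (x - 1) / (1 + t) + t powr (x + 1 - 1) / (1 + t)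
        = t powr (x - 1) * (1 + t) / (1 + t)"
      by (simp add: distrib_left add_divide_distrib)
    then show "t powr (x - 1) / (1 + t) + t powr (x + 1 - 1) / (1 + t) = t powr (x - 1)"
      using t by simp
  qed
  also have "\<dots> = 1 / x"
    using has_integral_powr_from_0[of "x - 1" 1] assms by (simp add: integral_unique)
  finally show ?thesis .
qed

text \<open>
  The factor \<open>2 ^ Suc m\<close> collects the \<open>1/2\<close> in front of the digamma difference and one
  inner derivative \<open>1/2\<close> for each differentiation.
\<close>

definition polygamma_gap :: "nat \<Rightarrow> real \<Rightarrow> real" where
  "polygamma_gap m x = (Polygamma m ((x + 1) / 2) - Polygamma m (x / 2)) / 2 ^ Suc m"

lemma polygamma_gap_sign:
  assumes "x > 0"
  shows "(- 1) ^ m * polygamma_gap m x \<ge> 0"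
proof (cases "even m")
  case True
  then show ?thesis
    using Polygamma_real_mono[of "x / 2" "(x + 1) / 2" m] assms by (simp add: polygamma_gap_def)
next
  case False
  then show ?thesis
    using Polygamma_real_strict_antimono[of "x / 2" "(x + 1) / 2" m] assms
    by (simp add: polygamma_gap_def divide_le_0_iff)
qed

lemma polygamma_gap_reflection:
  assumes "x > 0"
  shows "polygamma_gap 0 x + polygamma_gap 0 (x + 1) = 1 / x"
proof -
  have "(x + 1 + 1) / 2 = x / 2 + 1" by simp
  then show ?thesis
    using Digamma_plus1[of "x / 2"] assms by (simp add: polygamma_gap_def field_simps)
qed

lemma nielsen_beta_eq_Digamma:
  "x > 0 \<Longrightarrow> nielsen_beta x = polygamma_gap 0 x"
  using polygamma_gap_sign[of _ 0]
  by (intro reflection_solution_unique[of nielsen_beta "polygamma_gap 0"])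
     (auto simp: nielsen_beta_reflection nielsen_beta_nonneg polygamma_gap_reflection)

lemma has_field_derivative_polygamma_gap:
  assumes "x > 0"
  shows "(polygamma_gap m has_field_derivative polygamma_gap (Suc m) x) (at x)"
proof -
  have "(x + 1) / 2 \<notin> \<int>\<^sub>\<le>\<^sub>0" "x / 2 \<notin> \<int>\<^sub>\<le>\<^sub>0"
    using assms by (auto elim!: nonpos_Ints_cases)
  then show ?thesis
    unfolding polygamma_gap_def[abs_def]
    by (auto intro!: derivative_eq_intros simp: field_simps)
qed

lemma nielsen_beta_deriv_eq_polygamma_gap:
  "x > 0 \<Longrightarrow> nielsen_beta_deriv m x = polygamma_gap m x"
proof (induction m arbitrary: x)
  case 0
  then show ?case by (simp add: nielsen_beta_deriv_def nielsen_beta_eq_Digamma)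
next
  case (Suc m)
  have "eventually (\<lambda>z. z > 0) (nhds x)"
    using Suc.prems by (intro eventually_nhds_in_open[of "{0<..}", simplified]) auto
  then have "eventually (\<lambda>z. nielsen_beta_deriv m z = polygamma_gap m z) (nhds x)"
    by eventually_elim (rule Suc.IH)
  then have "deriv (nielsen_beta_deriv m) x = deriv (polygamma_gap m) x"
    by (intro deriv_cong_ev refl)
  also have "\<dots> = polygamma_gap (Suc m) x"
    using Suc.prems by (intro DERIV_imp_deriv has_field_derivative_polygamma_gap)
  finally show ?case by (simp add: nielsen_beta_deriv_def)
qed

lemma polygamma_gap_antimono:
  assumes "0 < x" "x \<le> y"
  shows "(- 1) ^ m * polygamma_gap m y \<le> (- 1) ^ m * polygamma_gap m x"
proof (rule DERIV_nonpos_imp_nonincreasing[OF assms(2)])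
  fix z assume "x \<le> z" "z \<le> y"
  then have "z > 0" using assms by simp
  then have "((\<lambda>z. (- 1) ^ m * polygamma_gap m z) has_field_derivative
      (- 1) ^ m * polygamma_gap (Suc m) z) (at z)"
    by (intro DERIV_cmult has_field_derivative_polygamma_gap)
  moreover have "(- 1) ^ m * polygamma_gap (Suc m) z \<le> 0"
    using polygamma_gap_sign[OF \<open>z > 0\<close>, of "Suc m"] by simp
  ultimately show "\<exists>d. ((\<lambda>z. (- 1) ^ m * polygamma_gap m z) has_field_derivative d) (at z) \<and> d \<le> 0"
    by blast
qed

theorem theorem2p19:
  fixes m :: nat and x y :: real
  assumes "x \<ge> 1" and "y \<ge> 1"
  shows "(nielsen_beta_deriv m (x * y))\<^sup>2 \<le> nielsen_beta_deriv m x * nielsen_beta_deriv m y"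
proof -
  define h where "h z = (- 1) ^ m * polygamma_gap m z" for z
  have h: "nielsen_beta_deriv m z * nielsen_beta_deriv m w = h z * h w" if "z > 0" "w > 0" for z w
  proof -
    have "((- 1) ^ m * (- 1) ^ m :: real) = 1"
      by (simp flip: power_mult_distrib)
    then show ?thesis
      using that by (simp add: nielsen_beta_deriv_eq_polygamma_gap h_def mult_ac)
  qed
  have "x \<le> x * y" "y \<le> x * y"
    using assms by (simp_all add: mult_le_cancel_left1 mult_le_cancel_right1)
  then have "h (x * y) \<le> h x" "h (x * y) \<le> h y"
    unfolding h_def using assms by (auto intro!: polygamma_gap_antimono)
  moreover have "0 \<le> h (x * y)" "0 \<le> h x"
    unfolding h_def using assms by (auto intro!: polygamma_gap_sign)
  ultimately have "h (x * y) * h (x * y) \<le> h x * h y"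
    by (intro mult_mono)
  then show ?thesis
    using assms by (simp add: power2_eq_square h)
qed

end
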